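(* In the setting described in the context, suppose that, as $n\to\infty$, $$C_n:=\frac1n\sum_{i=1}^n \mathrm{vec}(X_i)\mathrm{vec}(X_i)^{\intercal}\to C,\qquad D_n:=\frac1n\sum_{i=1}^n z_iz_i^{\intercal}\to D,\qquad H_n:=\frac1n\sum_{i=1}^n \mathrm{vec}(X_i)z_i^{\intercal}\to H,$$ where $C\in\mathbb{R}^{mq\times mq}$ and $D\in\mathbb{R}^{p\times p}$ are symmetric positive semidefinite and $H\in\mathbb{R}^{mq\times p}$, and suppose that the matrix $$S:=\begin{pmatrix} C & H\\ H^{\intercal} & D\end{pmatrix}$$ is positive definite. If $\rho_n/n\to\rho_0\ge 0$ and $\lambda_n/n\to\lambda_0\ge 0$, then $$(\widehat B_n,\hat\gamma_n)\to(\widehat B,\hat\gamma):=\underset{U\in\mathbb{R}^{m\times q},\,\beta\in\mathbb{R}^p}{\arg\min}\ Z(U,\beta)$$ in probability as $n\to\infty$, where $$Z(U,\beta):=\begin{pmatrix}\mathrm{vec}(U-B)\\ \beta-\gamma\end{pmatrix}^{\intercal} S\begin{pmatrix}\mathrm{vec}(U-B)\\ \beta-\gamma\end{pmatrix}+\rho_0\|U\|_*+\lambda_0\|\beta\|_1 .$$ In particular, if $\rho_n=o(n)$ and $\lambda_n=o(n)$, then $\arg\min_{U\in\mathbb{R}^{m\times q},\,\beta\in\mathbb{R}^p} Z(U,\beta)=(B,\gamma)$, and therefore $(\widehat B_n,\hat\gamma_n)$ is consistent, i.e. $(\widehat B_n,\hat\gamma_n)\to(B,\gamma)$ in probability.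
   Context: Fix positive integers $m,q,p$. The data follow the model $$y_i=\langle X_i,B\rangle+\langle z_i,\gamma\rangle+\varepsilon_i,\qquad i=1,2,\dots,$$ where $X_i\in\mathbb{R}^{m\times q}$ and $z_i\in\mathbb{R}^p$ are deterministic observed predictors, $B\in\mathbb{R}^{m\times q}$ and $\gamma\in\mathbb{R}^p$ are the fixed true regression coefficients, and the $\varepsilon_i$ are independent and identically distributed normal random variables with mean $0$ and standard deviation $\sigma$. Here $\langle X,Y\rangle=\mathrm{tr}(X^{\intercal}Y)$ for matrices and $\langle\cdot,\cdot\rangle$ is the standard inner product for vectors; $\mathrm{vec}(Y)\in\mathbb{R}^{mq}$ is the column vector obtained by stacking the columns of $Y\in\mathbb{R}^{m\times q}$; $\|\cdot\|_*$ is the nuclear norm and $\|\cdot\|_1$ is the $\ell_1$ norm of vectors. For given $n$ and deterministic penalty parameters $\rho_n\ge0$, $\lambda_n\ge0$, the estimator $(\widehat B_n,\hat\gamma_n)$ denotes a solution of $$\min_{U\in\mathbb{R}^{m\times q},\,\beta\in\mathbb{R}^p}\ Z_n(U,\beta):=\frac1n\sum_{i=1}^n\left(y_i-\langle X_i,U\rangle-\langle z_i,\beta\rangle\right)^2+\frac{\rho_n}{n}\|U\|_*+\frac{\lambda_n}{n}\|\beta\|_1 .$$ *)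

theory Defs
  imports "HOL-Probability.Probability" "HOL-Library.Landau_Symbols"
begin

text \<open>An \<open>m \<times> q\<close> real matrix has type \<open>real^'q^'m\<close>, so that \<open>Y $ i $ j\<close> is the entry in row \<open>i\<close>
  and column \<open>j\<close>.\<close>

definition mat_inner :: "real^'q^'m \<Rightarrow> real^'q^'m \<Rightarrow> real" where
  "mat_inner X Y = trace (transpose X ** Y)"

lemma mat_inner_eq_inner: "mat_inner X Y = X \<bullet> Y"
  unfolding mat_inner_def trace_def matrix_matrix_mult_def transpose_def inner_vec_def
  by simp (rule sum.swap)

text \<open>Column stacking. The \<open>mq\<close> coordinates are indexed by pairs (column, row) rather than by
  numbers, so the position \<open>(j - 1) m + i\<close> of the stacked vector is written \<open>(j, i)\<close>.\<close>

definition vectorize :: "real^'q^'m \<Rightarrow> real^('q \<times> 'm)" where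
  "vectorize Y = (\<chi> k. Y $ snd k $ fst k)"

definition outer_product :: "real^'a \<Rightarrow> real^'b \<Rightarrow> real^'b^'a" where
  "outer_product u v = (\<chi> i j. u $ i * v $ j)"

definition l1_norm :: "real^'p \<Rightarrow> real" where
  "l1_norm b = (\<Sum>i\<in>UNIV. \<bar>b $ i\<bar>)"

text \<open>The singular values of \<open>X\<close> are the square roots of the eigenvalues of \<open>X\<^sup>T X\<close>; the
  multiplicity of a singular value is the dimension of the corresponding eigenspace of \<open>X\<^sup>T X\<close>.
  Padding by zero singular values (when \<open>q > m\<close>) does not affect the sum below.\<close>

definition singular_space :: "real^'q^'m \<Rightarrow> real \<Rightarrow> (real^'q) set" where
  "singular_space X s = {v. (transpose X ** X) *v v = s\<^sup>2 *\<^sub>R v}"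

definition singular_values :: "real^'q^'m \<Rightarrow> real set" where
  "singular_values X = {s. s \<ge> 0 \<and> (\<exists>v\<in>singular_space X s. v \<noteq> 0)}"

definition nuclear_norm :: "real^'q^'m \<Rightarrow> real" where
  "nuclear_norm X = (\<Sum>s\<in>singular_values X. real (dim (singular_space X s)) * s)"

lemma finite_singular_values: "finite (singular_values X)"
proof -
  define f where "f s = (SOME v. v \<in> singular_space X s \<and> v \<noteq> 0)" for s
  have f: "f s \<in> singular_space X s" "f s \<noteq> 0" if "s \<in> singular_values X" for s
    using that someI_ex[of "\<lambda>v. v \<in> singular_space X s \<and> v \<noteq> 0"]
    unfolding singular_values_def f_def by auto
  have sym: "(transpose X ** X *v u) \<bullet> v = u \<bullet> (transpose X ** X *v v)" for u v
    by (metis dot_lmul_matrix matrix_transpose_mul transpose_transpose vector_transpose_matrix)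
  have orth: "f s \<bullet> f t = 0"
    if "s \<in> singular_values X" "t \<in> singular_values X" "s \<noteq> t" for s t
  proof -
    have "s\<^sup>2 * (f s \<bullet> f t) = t\<^sup>2 * (f s \<bullet> f t)"
      using sym[of "f s" "f t"] f(1)[OF that(1)] f(1)[OF that(2)]
      unfolding singular_space_def by simp
    moreover have "s\<^sup>2 \<noteq> t\<^sup>2"
      using that unfolding singular_values_def by simp
    ultimately show ?thesis by simp
  qed
  have "inj_on f (singular_values X)"
    by (rule inj_onI) (metis f(2) inner_eq_zero_iff orth)
  moreover have "independent (f ` singular_values X)"
  proof (rule pairwise_orthogonal_independent)
    show "pairwise orthogonal (f ` singular_values X)"
      unfolding pairwise_def orthogonal_def using orth by force
    show "0 \<notin> f ` singular_values X" using f(2) by force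
  qed
  ultimately show ?thesis
    using finiteI_independent finite_imageD by blast
qed

definition symmetric_mat :: "real^'n^'n \<Rightarrow> bool" where
  "symmetric_mat A \<longleftrightarrow> transpose A = A"

definition pos_semidef :: "real^'n^'n \<Rightarrow> bool" where
  "pos_semidef A \<longleftrightarrow> symmetric_mat A \<and> (\<forall>x. x \<bullet> (A *v x) \<ge> 0)"

definition pos_def :: "real^'n^'n \<Rightarrow> bool" where
  "pos_def A \<longleftrightarrow> symmetric_mat A \<and> (\<forall>x. x \<noteq> 0 \<longrightarrow> x \<bullet> (A *v x) > 0)"

definition stack :: "real^'a \<Rightarrow> real^'b \<Rightarrow> real^('a + 'b)" where
  "stack u v = (\<chi> k. case k of Inl a \<Rightarrow> u $ a | Inr b \<Rightarrow> v $ b)"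

definition block_mat ::
  "real^'a^'a \<Rightarrow> real^'b^'a \<Rightarrow> real^'a^'b \<Rightarrow> real^'b^'b \<Rightarrow> real^('a + 'b)^('a + 'b)" where
  "block_mat P Q R T = (\<chi> i. case i of Inl a \<Rightarrow> stack (P $ a) (Q $ a) | Inr b \<Rightarrow> stack (R $ b) (T $ b))"

definition Zn ::
  "(nat \<Rightarrow> real^'q^'m) \<Rightarrow> (nat \<Rightarrow> real^'p) \<Rightarrow> (nat \<Rightarrow> real) \<Rightarrow> (nat \<Rightarrow> real) \<Rightarrow> (nat \<Rightarrow> real) \<Rightarrow> nat
    \<Rightarrow> (real^'q^'m) \<times> (real^'p) \<Rightarrow> real" where
  "Zn X z y \<rho> lam n = (\<lambda>(U, \<beta>).
     1 / real n * (\<Sum>i=1..n. (y i - mat_inner (X i) U - z i \<bullet> \<beta>)\<^sup>2)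
       + \<rho> n / real n * nuclear_norm U + lam n / real n * l1_norm \<beta>)"

definition Zlim ::
  "real^(('q \<times> 'm) + 'p)^(('q \<times> 'm) + 'p) \<Rightarrow> real^'q^'m \<Rightarrow> real^'p \<Rightarrow> real \<Rightarrow> real
    \<Rightarrow> (real^'q^'m) \<times> (real^'p) \<Rightarrow> real" where
  "Zlim S B \<gamma> \<rho>0 lam0 = (\<lambda>(U, \<beta>).
     stack (vectorize (U - B)) (\<beta> - \<gamma>) \<bullet> (S *v stack (vectorize (U - B)) (\<beta> - \<gamma>))
       + \<rho>0 * nuclear_norm U + lam0 * l1_norm \<beta>)"

abbreviation is_minimizer :: "('b \<Rightarrow> real) \<Rightarrow> 'b \<Rightarrow> bool" where
  "is_minimizer f x \<equiv> is_arg_min f (\<lambda>_. True) x"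

text \<open>Convergence in probability to a constant; meant for random variables \<open>T n\<close>, since the
  measure of a non-measurable set is \<open>0\<close> by convention.\<close>

definition tendsto_in_prob :: "'a measure \<Rightarrow> (nat \<Rightarrow> 'a \<Rightarrow> 'b::metric_space) \<Rightarrow> 'b \<Rightarrow> bool" where
  "tendsto_in_prob M T l \<longleftrightarrow>
     (\<forall>e>0. (\<lambda>n. measure M {\<omega>\<in>space M. dist (T n \<omega>) l > e}) \<longlonglongrightarrow> 0)"

end

theory Submission
  imports Defs
begin

text \<open>With \<open>w\<close> the coordinate vector of \<open>\<theta> - (B, \<gamma>)\<close> and \<open>g\<^sub>n\<close> the average of the vectors
  \<open>\<epsilon>\<^sub>i \<xi>\<^sub>i\<close>, where \<open>\<xi>\<^sub>i\<close> stacks \<open>X\<^sub>i\<close> and \<open>z\<^sub>i\<close>, the objective \<open>Z\<^sub>n\<close> differs from its limit \<open>Z\<close> by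
  a constant, the random linear term \<open>-2 g\<^sub>n \<bullet> w\<close>, and deterministic terms that vanish uniformly on
  bounded sets. Since \<open>Z\<close> grows at least quadratically away from its minimizer \<open>\<theta>\<close> and \<open>Z\<^sub>n\<close> is
  convex, a minimizer of \<open>Z\<^sub>n\<close> at distance more than \<open>e\<close> from \<open>\<theta>\<close> would give a point at distance
  exactly \<open>e\<close> where the two objectives differ substantially; for large \<open>n\<close> this forces \<open>g\<^sub>n\<close> to be
  bounded away from zero. As \<open>E |g\<^sub>n|\<^sup>2 = \<sigma>\<^sup>2 tr(S\<^sub>n) / n\<close>, with \<open>S\<^sub>n\<close> the empirical second moment
  matrix of the \<open>\<xi>\<^sub>i\<close>, the probability of this event tends to zero by Markov's inequality. Convexity
  of the nuclear norm comes from its description as the maximum of \<open>X \<bullet> W\<close> over contractions \<open>W\<close>.\<close>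

subsection \<open>The nuclear norm\<close>

text \<open>A maximizer \<open>v\<close> of the Rayleigh quotient on the unit sphere of
  \<open>V\<close> works. The quadratic form \<open>\<phi>\<close> is nonnegative on
  \<open>V\<close> and vanishes at \<open>v\<close>, so it cannot decrease in the direction of the
  residual \<open>u = f v - l v\<close>, which forces \<open>u = 0\<close>. Restricting to an
  invariant subspace allows an application to an orthogonal complement below.\<close>

lemma self_adjoint_has_eigenvector:
  fixes f :: "'a::euclidean_space \<Rightarrow> 'a"
  assumes lin: "linear f" and sa: "\<And>x y. f x \<bullet> y = x \<bullet> f y"
    and V: "subspace V" "f ` V \<subseteq> V" "V \<noteq> {0}"
  obtains v l where "v \<in> V" "v \<noteq> 0" "f v = l *\<^sub>R v"
proof -
  obtain x where x: "x \<in> V" "x \<noteq> 0"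
    using V subspace_0 by blast
  have cont: "continuous_on (sphere 0 1 \<inter> V) (\<lambda>x. x \<bullet> f x)"
    using lin by (intro continuous_intros linear_continuous_on) (simp add: linear_conv_bounded_linear)
  have "compact (sphere 0 1 \<inter> V)"
    using V(1) by (simp add: closed_subspace compact_Int_closed)
  moreover have "sgn x \<in> sphere 0 1 \<inter> V"
    using x V(1) by (simp add: sgn_div_norm subspace_scale)
  ultimately obtain v where v: "v \<in> sphere 0 1 \<inter> V"
      and max: "\<And>x. x \<in> sphere 0 1 \<inter> V \<Longrightarrow> x \<bullet> f x \<le> v \<bullet> f v"
    using continuous_attains_sup[OF _ _ cont] by blast
  define l where "l = v \<bullet> f v"
  define \<phi> where "\<phi> x = l * (x \<bullet> x) - x \<bullet> f x" for x
  have phi_nonneg: "\<phi> x \<ge> 0" if "x \<in> V" for x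
  proof (cases "x = 0")
    case False
    have "sgn x \<bullet> f (sgn x) \<le> l"
      unfolding l_def using that False V(1) by (intro max) (simp add: sgn_div_norm subspace_scale)
    then have "(x \<bullet> f x) / (norm x)\<^sup>2 \<le> l"
      using lin by (simp add: sgn_div_norm linear_scale power2_eq_square divide_simps)
    then show ?thesis
      using False by (simp add: \<phi>_def divide_simps power2_norm_eq_inner split: if_splits)
  qed (simp add: \<phi>_def)
  define u where "u = f v - l *\<^sub>R v"
  have uV: "u \<in> V"
    using v V unfolding u_def by (auto intro!: subspace_diff subspace_scale)
  have vv: "v \<bullet> v = 1" using v by (simp add: dot_square_norm)
  have expand: "\<phi> (v + t *\<^sub>R u) = t\<^sup>2 * \<phi> u - 2 * t * (u \<bullet> u)" for t
  proof -
    have "u \<bullet> u = u \<bullet> f v - l * (u \<bullet> v)"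
      unfolding u_def by (simp add: inner_diff_right)
    moreover have "f (v + t *\<^sub>R u) = f v + t *\<^sub>R f u"
      using lin by (simp add: linear_add linear_scale)
    moreover have "v \<bullet> f u = u \<bullet> f v"
      using sa[of v u] by (simp add: inner_commute)
    ultimately have "\<phi> (v + t *\<^sub>R u) = t\<^sup>2 * \<phi> u - 2 * t * (u \<bullet> f v - l * (u \<bullet> v))"
      using vv unfolding \<phi>_def
      by (simp add: inner_add_left inner_add_right inner_commute[of v u] power2_eq_square
          algebra_simps flip: l_def)
    then show ?thesis using \<open>u \<bullet> u = _\<close> by simp
  qed
  \<comment> \<open>Along \<open>u\<close> the form \<open>\<phi>\<close> starts with slope
    \<open>-2 (u \<bullet> u)\<close>, so a small enough step makes it negative unless
    \<open>u = 0\<close>. The added 1 keeps the denominator positive when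
    \<open>\<phi> u = 0\<close> and still gives
    \<open>t * \<phi> u \<le> u \<bullet> u\<close>.\<close>
  define t where "t = (u \<bullet> u) / (\<phi> u + 1)"
  have phi_u: "\<phi> u \<ge> 0" using phi_nonneg uV .
  have "u = 0"
  proof (rule ccontr)
    assume "u \<noteq> 0"
    then have t: "t > 0" using phi_u by (simp add: t_def)
    have "0 \<le> \<phi> (v + t *\<^sub>R u)"
      using v uV V(1) by (intro phi_nonneg) (simp add: subspace_add subspace_scale)
    then have "0 \<le> t * (t * \<phi> u - 2 * (u \<bullet> u))"
      unfolding expand by (simp add: power2_eq_square algebra_simps)
    then have "2 * (u \<bullet> u) \<le> t * \<phi> u"
      using t by (simp add: zero_le_mult_iff)
    also have "\<dots> \<le> t * (\<phi> u + 1)" using t by simp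
    also have "\<dots> = u \<bullet> u" using phi_u by (simp add: t_def)
    finally show False using \<open>u \<noteq> 0\<close> by (simp add: not_le)
  qed
  then have "f v = l *\<^sub>R v" by (simp add: u_def)
  moreover have "v \<noteq> 0" using vv by auto
  ultimately show ?thesis using that v by blast
qed

text \<open>With the arguments exchanged this yields the symmetry of the Gram matrix, with equal
  arguments its positive semidefiniteness.\<close>

lemma gram_inner: "(transpose X ** X *v u) \<bullet> v = (X *v u) \<bullet> (X *v v)"
  for X :: "real^'q^'m"
  by (metis dot_lmul_matrix inner_commute matrix_vector_mul_assoc vector_transpose_matrix)

lemma subspace_singular_space: "subspace (singular_space X s)"
  unfolding subspace_def singular_space_def
  by (auto simp: matrix_vector_right_distrib matrix_vector_mult_scaleR scaleR_add_right)

text \<open>Orthonormal bases of the singular spaces together form a basis of right singular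
  vectors, since eigenspaces of the Gram matrix for different eigenvalues are orthogonal. Each basis
  vector contributes its singular value \<open>norm (X *v b)\<close>, so multiplicities are counted
  by the number of vectors. The Parseval identity expresses completeness in the form used
  later.\<close>

lemma nuclear_norm_orthonormal_basis:
  fixes X :: "real^'q^'m"
  shows "\<exists>\<B>. finite \<B> \<and> pairwise orthogonal \<B> \<and> (\<forall>b\<in>\<B>. norm b = 1) \<and>
    (\<forall>x y. (\<Sum>b\<in>\<B>. (b \<bullet> x) * (b \<bullet> y)) = x \<bullet> y) \<and>
    pairwise (\<lambda>b c. orthogonal (X *v b) (X *v c)) \<B> \<and>
    nuclear_norm X = (\<Sum>b\<in>\<B>. norm (X *v b))"
proof -
  let ?G = "transpose X ** X"
  have "\<exists>E. E \<subseteq> singular_space X s \<and> pairwise orthogonal E \<and> (\<forall>x\<in>E. norm x = 1) \<and>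
      independent E \<and> card E = dim (singular_space X s) \<and> span E = singular_space X s" for s
    using orthonormal_basis_subspace[OF subspace_singular_space[of X s]] by metis
  then obtain E where E: "\<And>s. E s \<subseteq> singular_space X s" "\<And>s. pairwise orthogonal (E s)"
      "\<And>s x. x \<in> E s \<Longrightarrow> norm x = 1" "\<And>s. independent (E s)"
      "\<And>s. card (E s) = dim (singular_space X s)" "\<And>s. span (E s) = singular_space X s"
    by metis
  define \<B> where "\<B> = (\<Union>s\<in>singular_values X. E s)"
  have finE: "finite (E s)" for s using E(4) finiteI_independent by blast
  have eig: "?G *v b = s\<^sup>2 *\<^sub>R b" if "b \<in> E s" for b s
    using E(1) that unfolding singular_space_def by blast
  have orth_eig: "b \<bullet> c = 0"
    if "s \<in> singular_values X" "t \<in> singular_values X" "s \<noteq> t" "b \<in> E s" "c \<in> E t" for s t b c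
  proof -
    have "s\<^sup>2 * (b \<bullet> c) = t\<^sup>2 * (b \<bullet> c)"
      using gram_inner[of X b c] gram_inner[of X c b] eig[OF that(4)] eig[OF that(5)]
      by (simp add: inner_commute)
    moreover have "s\<^sup>2 \<noteq> t\<^sup>2"
      using that unfolding singular_values_def by simp
    ultimately show ?thesis by simp
  qed
  have fin: "finite \<B>" unfolding \<B>_def using finite_singular_values finE by blast
  have orth: "pairwise orthogonal \<B>"
    unfolding pairwise_def
  proof (intro ballI impI)
    fix b c assume "b \<in> \<B>" "c \<in> \<B>" "b \<noteq> c"
    then obtain s t where "s \<in> singular_values X" "t \<in> singular_values X" "b \<in> E s" "c \<in> E t"
      unfolding \<B>_def by blast
    then show "orthogonal b c"
      using orth_eig[of s t b c] E(2)[of s] \<open>b \<noteq> c\<close>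
      by (cases "s = t") (auto simp: pairwise_def orthogonal_def)
  qed
  have unit: "norm b = 1" if "b \<in> \<B>" for b
    using that E(3) unfolding \<B>_def by blast
  have orthX: "pairwise (\<lambda>b c. orthogonal (X *v b) (X *v c)) \<B>"
    unfolding pairwise_def
  proof (intro ballI impI)
    fix b c assume bc: "b \<in> \<B>" "c \<in> \<B>" "b \<noteq> c"
    then obtain s where "b \<in> E s" unfolding \<B>_def by blast
    then show "orthogonal (X *v b) (X *v c)"
      using gram_inner[of X b c] eig orth bc by (simp add: orthogonal_def pairwise_def)
  qed
  have normX: "norm (X *v b) = s" if "b \<in> E s" "s \<in> singular_values X" for b s
  proof -
    have "(norm (X *v b))\<^sup>2 = s\<^sup>2 * (norm b)\<^sup>2"
      using gram_inner[of X b b] eig[OF that(1)] by (simp add: power2_norm_eq_inner)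
    then show ?thesis
      using that E(3)[OF that(1)] by (simp add: singular_values_def)
  qed
  have nuc: "nuclear_norm X = (\<Sum>b\<in>\<B>. norm (X *v b))"
  proof -
    have disj: "E s \<inter> E t = {}"
      if "s \<in> singular_values X" "t \<in> singular_values X" "s \<noteq> t" for s t
    proof (rule ccontr)
      assume "E s \<inter> E t \<noteq> {}"
      then obtain b where "b \<in> E s" "b \<in> E t" by blast
      with orth_eig[OF that] E(3) show False by force
    qed
    have "(\<Sum>b\<in>\<B>. norm (X *v b)) = (\<Sum>s\<in>singular_values X. \<Sum>b\<in>E s. norm (X *v b))"
      unfolding \<B>_def using finite_singular_values finE disj by (intro sum.UNION_disjoint) auto
    also have "\<dots> = (\<Sum>s\<in>singular_values X. \<Sum>b\<in>E s. s)"
      using normX by (intro sum.cong) auto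
    finally show ?thesis by (simp add: nuclear_norm_def E(5))
  qed
  \<comment> \<open>Completeness: the orthogonal complement of the basis is invariant under the
    symmetric Gram matrix. If nonzero, it contains an eigenvector with eigenvalue
    \<open>l \<ge> 0\<close>, which lies in the singular space of \<open>sqrt l\<close>; that space
    is spanned by vectors orthogonal to it, a contradiction.\<close>
  define V where "V = {x. \<forall>b\<in>\<B>. b \<bullet> x = 0}"
  have V0: "V = {0}"
  proof (rule ccontr)
    assume ne: "V \<noteq> {0}"
    have sub: "subspace V" unfolding V_def subspace_def by (simp add: inner_add_right)
    have sa: "(?G *v x) \<bullet> y = x \<bullet> (?G *v y)" for x y
      using gram_inner[of X x y] gram_inner[of X y x] by (simp add: inner_commute)
    have inv: "(\<lambda>x. ?G *v x) ` V \<subseteq> V"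
    proof -
      have "b \<bullet> (?G *v x) = 0" if x: "x \<in> V" and b: "b \<in> \<B>" for x b
      proof -
        obtain s where "b \<in> E s" using b unfolding \<B>_def by blast
        then show ?thesis using x b sa[of b x] eig by (simp add: V_def)
      qed
      then show ?thesis by (auto simp: V_def)
    qed
    obtain v l where v: "v \<in> V" "v \<noteq> 0" "?G *v v = l *\<^sub>R v"
      using self_adjoint_has_eigenvector[of "\<lambda>x. ?G *v x" V] sa sub inv ne by auto
    have "l * (v \<bullet> v) \<ge> 0"
      using gram_inner[of X v v] v(3) by simp
    then have "l \<ge> 0" using v(2) by (metis inner_gt_zero_iff not_le zero_le_mult_iff)
    then have "v \<in> singular_space X (sqrt l)"
      using v(3) by (simp add: singular_space_def)
    then have "v \<in> span (E (sqrt l))" "sqrt l \<in> singular_values X"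
      using E(6) v(2) \<open>l \<ge> 0\<close> by (auto simp: singular_values_def)
    moreover from this(2) have "\<And>b. b \<in> E (sqrt l) \<Longrightarrow> orthogonal v b"
      using v(1) by (auto simp: V_def \<B>_def orthogonal_def inner_commute)
    ultimately have "orthogonal v v" using orthogonal_to_span by blast
    then show False using v(2) by (simp add: orthogonal_def)
  qed
  have parseval: "(\<Sum>b\<in>\<B>. (b \<bullet> x) * (b \<bullet> y)) = x \<bullet> y" for x y
  proof -
    \<comment> \<open>The remainder of the expansion of \<open>x\<close> is orthogonal to the basis,
      hence lies in the trivial complement \<open>V\<close>.\<close>
    have "c \<bullet> (x - (\<Sum>b\<in>\<B>. (b \<bullet> x) *\<^sub>R b)) = 0" if "c \<in> \<B>" for c
    proof -
      have "c \<bullet> (\<Sum>b\<in>\<B>. (b \<bullet> x) *\<^sub>R b) = (\<Sum>b\<in>\<B>. if b = c then c \<bullet> x else 0)"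
        unfolding inner_sum_right using that orth unit
        by (intro sum.cong) (auto simp: pairwise_def orthogonal_def dot_square_norm)
      then show ?thesis using that fin by (simp add: inner_diff_right)
    qed
    then have "x - (\<Sum>b\<in>\<B>. (b \<bullet> x) *\<^sub>R b) = 0"
      using V0 unfolding V_def by blast
    then have "x \<bullet> y = (\<Sum>b\<in>\<B>. (b \<bullet> x) *\<^sub>R b) \<bullet> y" by simp
    then show ?thesis by (simp add: inner_sum_left)
  qed
  show ?thesis using fin orth unit parseval orthX nuc by blast
qed

section \<open>Duality between the nuclear norm and contractions\<close>

lemma matrix_inner_orthonormal_basis:
  fixes A W :: "real^'q^'m"
  assumes "\<And>x y. (\<Sum>b\<in>\<B>. (b \<bullet> x) * (b \<bullet> y)) = x \<bullet> y"
  shows "A \<bullet> W = (\<Sum>b\<in>\<B>. (A *v b) \<bullet> (W *v b))"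
proof -
  have "A \<bullet> W = (\<Sum>i\<in>UNIV. \<Sum>b\<in>\<B>. (b \<bullet> A $ i) * (b \<bullet> W $ i))"
    using assms by (simp add: inner_vec_def)
  also have "\<dots> = (\<Sum>b\<in>\<B>. \<Sum>i\<in>UNIV. (b \<bullet> A $ i) * (b \<bullet> W $ i))"
    by (rule sum.swap)
  finally show ?thesis
    by (simp add: inner_vec_def[of "_ *v _"] matrix_vector_mul_component inner_commute)
qed

text \<open>The unit ball of the spectral norm, whose dual norm is the nuclear norm.\<close>

definition contraction :: "real^'q^'m \<Rightarrow> bool" where
  "contraction W \<longleftrightarrow> (\<forall>v. norm (W *v v) \<le> norm v)"

text \<open>In the basis of right singular vectors of \<open>X\<close>, Cauchy-Schwarz bounds each
  summand of the inner product by one singular value.\<close>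

lemma inner_contraction_le_nuclear_norm:
  assumes "contraction W"
  shows "X \<bullet> W \<le> nuclear_norm X"
proof -
  obtain \<B> where B: "finite \<B>" "pairwise orthogonal \<B>" "\<forall>b\<in>\<B>. norm b = 1"
      "\<forall>x y. (\<Sum>b\<in>\<B>. (b \<bullet> x) * (b \<bullet> y)) = x \<bullet> y"
      "pairwise (\<lambda>b c. orthogonal (X *v b) (X *v c)) \<B>"
      "nuclear_norm X = (\<Sum>b\<in>\<B>. norm (X *v b))"
    using nuclear_norm_orthonormal_basis[of X] by blast
  have "(X *v b) \<bullet> (W *v b) \<le> norm (X *v b)" if "b \<in> \<B>" for b
  proof -
    have "norm (W *v b) \<le> 1"
      using assms B(3) that by (metis contraction_def)
    then show ?thesis
      using norm_cauchy_schwarz[of "X *v b" "W *v b"]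
        mult_left_mono[of "norm (W *v b)" 1 "norm (X *v b)"] by simp
  qed
  then show ?thesis
    unfolding matrix_inner_orthonormal_basis[OF B(4)[rule_format]] B(6) by (intro sum_mono)
qed

lemma nuclear_norm_eq_inner_contraction:
  fixes X :: "real^'q^'m"
  obtains W where "contraction W" "nuclear_norm X = X \<bullet> W"
proof -
  obtain \<B> where B: "finite \<B>" "pairwise orthogonal \<B>" "\<forall>b\<in>\<B>. norm b = 1"
      "\<forall>x y. (\<Sum>b\<in>\<B>. (b \<bullet> x) * (b \<bullet> y)) = x \<bullet> y"
      "pairwise (\<lambda>b c. orthogonal (X *v b) (X *v c)) \<B>"
      "nuclear_norm X = (\<Sum>b\<in>\<B>. norm (X *v b))"
    using nuclear_norm_orthonormal_basis[of X] by blast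
  \<comment> \<open>The partial isometry of the polar decomposition: it sends each right singular
    vector \<open>b\<close> to the direction of \<open>X *v b\<close>, and to 0 when
    \<open>X *v b = 0\<close>, as \<open>sgn 0 = 0\<close>. These images are orthogonal with norm at
    most 1, so Pythagoras and Parseval make \<open>f\<close> a contraction.\<close>
  define f where "f u = (\<Sum>b\<in>\<B>. (b \<bullet> u) *\<^sub>R sgn (X *v b))" for u
  have "linear f"
    unfolding f_def
    by (intro linear_compose_sum ballI) (auto intro!: linearI simp: inner_add_right scaleR_add_left)
  then have W: "matrix f *v u = f u" for u by (simp add: matrix_works)
  have "norm (f u) \<le> norm u" for u
  proof -
    have "(norm (f u))\<^sup>2 = (\<Sum>b\<in>\<B>. (norm ((b \<bullet> u) *\<^sub>R sgn (X *v b)))\<^sup>2)"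
      unfolding f_def using B(1,5)
      by (intro norm_sum_Pythagorean) (auto simp: pairwise_def orthogonal_def sgn_div_norm)
    also have "\<dots> \<le> (\<Sum>b\<in>\<B>. (b \<bullet> u) * (b \<bullet> u))"
      by (intro sum_mono) (auto simp: power2_eq_square norm_sgn)
    also have "\<dots> = (norm u)\<^sup>2" by (simp add: B(4) power2_norm_eq_inner)
    finally show ?thesis by (simp add: power2_le_iff_abs_le)
  qed
  then have "contraction (matrix f)" by (simp add: contraction_def W)
  moreover have "nuclear_norm X = X \<bullet> matrix f"
  proof -
    have "f b = sgn (X *v b)" if "b \<in> \<B>" for b
    proof -
      have "f b = (\<Sum>c\<in>\<B>. if c = b then sgn (X *v b) else 0)"
        unfolding f_def using that B(2,3)
        by (intro sum.cong) (auto simp: pairwise_def orthogonal_def dot_square_norm)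
      then show ?thesis using that B(1) by simp
    qed
    moreover have "a \<bullet> sgn a = norm a" for a :: "real^'m"
      by (cases "a = 0") (simp_all add: sgn_div_norm dot_square_norm power2_eq_square)
    ultimately show ?thesis
      unfolding matrix_inner_orthonormal_basis[OF B(4)[rule_format]] B(6) W by (intro sum.cong) auto
  qed
  ultimately show ?thesis using that by blast
qed

section \<open>Convexity of the two norms\<close>

lemma nuclear_norm_nonneg: "nuclear_norm X \<ge> 0"
  unfolding nuclear_norm_def by (intro sum_nonneg) (auto simp: singular_values_def)

lemma convex_on_nuclear_norm: "convex_on UNIV nuclear_norm"
proof (rule convex_onI)
  fix t :: real and X Y :: "real^'q^'m"
  assume t: "0 < t" "t < 1"
  let ?Z = "(1 - t) *\<^sub>R X + t *\<^sub>R Y"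
  \<comment> \<open>The contraction that is optimal for the convex combination is a competitor at
    both endpoints.\<close>
  obtain W where W: "contraction W" "nuclear_norm ?Z = ?Z \<bullet> W"
    using nuclear_norm_eq_inner_contraction[of ?Z] by blast
  then show "nuclear_norm ?Z \<le> (1 - t) * nuclear_norm X + t * nuclear_norm Y"
    using t inner_contraction_le_nuclear_norm[OF W(1)]
    by (auto simp: inner_add_left intro!: add_mono mult_left_mono)
qed simp

lemma l1_norm_nonneg: "l1_norm b \<ge> 0"
  unfolding l1_norm_def by (intro sum_nonneg) auto

lemma convex_on_l1_norm: "convex_on UNIV l1_norm"
proof (rule convex_onI)
  fix t :: real and x y :: "real^'p"
  assume t: "0 < t" "t < 1"
  have "\<bar>(1 - t) * x $ i + t * y $ i\<bar> \<le> (1 - t) * \<bar>x $ i\<bar> + t * \<bar>y $ i\<bar>" for i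
    using t abs_triangle_ineq[of "(1 - t) * x $ i" "t * y $ i"] by (simp add: abs_mult)
  then show "l1_norm ((1 - t) *\<^sub>R x + t *\<^sub>R y) \<le> (1 - t) * l1_norm x + t * l1_norm y"
    unfolding l1_norm_def sum_distrib_left sum.distrib[symmetric] by (intro sum_mono) simp
qed simp

subsection \<open>The limiting objective\<close>

text \<open>The norm of the matrix type is the Frobenius norm, so this is Cauchy-Schwarz row by row.
  It turns convergence of matrices into uniform convergence of their quadratic forms on bounded
  sets.\<close>

lemma norm_matrix_vector_mult_le:
  fixes A :: "real^'n^'m"
  shows "norm (A *v x) \<le> norm A * norm x"
proof -
  have "\<bar>(A *v x) $ i\<bar> \<le> norm (A $ i) * norm x" for i
    by (simp add: matrix_vector_mul_component Cauchy_Schwarz_ineq2)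
  then have "norm (A *v x) \<le> L2_set (\<lambda>i. norm (A $ i) * norm x) UNIV"
    unfolding norm_vec_def[of "A *v x"] by (intro L2_set_mono) auto
  also have "\<dots> = norm A * norm x"
    by (simp add: L2_set_left_distrib norm_vec_def[of A])
  finally show ?thesis .
qed

text \<open>The constant is the minimum of the quadratic form on the compact unit sphere;
  homogeneity extends the bound to all vectors.\<close>

lemma pos_def_coercive:
  fixes S :: "real^'n^'n"
  assumes "pos_def S"
  obtains c where "c > 0" "\<And>v. c * (norm v)\<^sup>2 \<le> v \<bullet> (S *v v)"
proof -
  have cont: "continuous_on (sphere 0 1) (\<lambda>v. v \<bullet> (S *v v))"
    by (intro continuous_on_inner continuous_on_id linear_continuous_on matrix_vector_mul_bounded_linear)
  have "axis undefined 1 \<in> sphere (0::real^'n) 1" by simp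
  then have "sphere (0::real^'n) 1 \<noteq> {}" by blast
  then obtain v0 where v0: "v0 \<in> sphere 0 1"
      and min: "\<And>v. v \<in> sphere 0 1 \<Longrightarrow> v0 \<bullet> (S *v v0) \<le> v \<bullet> (S *v v)"
    using continuous_attains_inf[OF compact_sphere _ cont] by blast
  have "v0 \<noteq> 0" using v0 by auto
  then have "v0 \<bullet> (S *v v0) > 0" using assms by (simp add: pos_def_def)
  moreover have "(v0 \<bullet> (S *v v0)) * (norm v)\<^sup>2 \<le> v \<bullet> (S *v v)" for v
  proof (cases "v = 0")
    case False
    have "v0 \<bullet> (S *v v0) \<le> sgn v \<bullet> (S *v sgn v)"
      using False by (intro min) (simp add: norm_sgn)
    then show ?thesis
      using False by (simp add: sgn_div_norm matrix_vector_mult_scaleR power2_eq_square field_simps)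
  qed simp
  ultimately show ?thesis by (rule that)
qed

text \<open>If \<open>x\<close> were farther than \<open>e\<close> from \<open>x0\<close>, the
  segment between them would contain a point at distance exactly \<open>e\<close>, where convexity
  keeps \<open>G\<close> below \<open>G x0\<close>. But \<open>F\<close> has risen there by
  \<open>k * e\<^sup>2\<close>, while closeness at the two points allows a discrepancy of at most
  \<open>2 * a\<close>.\<close>

lemma perturbed_minimizer_close:
  fixes F G :: "'a::real_normed_vector \<Rightarrow> real"
  assumes conv: "convex_on UNIV G"
    and growth: "\<And>x. F x0 + k * (norm (x - x0))\<^sup>2 \<le> F x"
    and close: "\<And>x. norm (x - x0) \<le> e \<Longrightarrow> \<bar>G x - F x\<bar> \<le> a"
    and e: "e > 0" and a: "2 * a < k * e\<^sup>2" and min: "G x \<le> G x0"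
  shows "dist x x0 \<le> e"
proof (rule ccontr)
  assume "\<not> dist x x0 \<le> e"
  then have d: "norm (x - x0) > e" by (simp add: dist_norm)
  define t where "t = e / norm (x - x0)"
  have t: "0 < t" "t < 1" using d e order.strict_trans[OF e d] by (auto simp: t_def simp del: zero_less_norm_iff)
  define x' where "x' = (1 - t) *\<^sub>R x0 + t *\<^sub>R x"
  have "x' - x0 = t *\<^sub>R (x - x0)" by (simp add: x'_def algebra_simps)
  then have x': "norm (x' - x0) = e" using d e by (auto simp: t_def)
  have "G x' \<le> (1 - t) * G x0 + t * G x"
    unfolding x'_def using t conv by (intro convex_onD) auto
  also have "\<dots> \<le> G x0"
    using t min mult_left_mono[of "G x" "G x0" t] by (simp add: algebra_simps)
  finally have "G x' \<le> G x0" .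
  moreover have "F x0 + k * e\<^sup>2 \<le> F x'" using growth[of x'] x' by simp
  moreover have "\<bar>G x' - F x'\<bar> \<le> a" "\<bar>G x0 - F x0\<bar> \<le> a"
    using close x' e by auto
  ultimately show False using a by linarith
qed

section \<open>Flattening of parameter pairs, and the penalty term\<close>

definition coord :: "(real^'q^'m) \<times> (real^'p) \<Rightarrow> real^(('q \<times> 'm) + 'p)" where
  "coord \<theta> = stack (vectorize (fst \<theta>)) (snd \<theta>)"

lemma coord_Inl [simp]: "coord \<theta> $ Inl (j, i) = fst \<theta> $ i $ j"
  and coord_Inr [simp]: "coord \<theta> $ Inr k = snd \<theta> $ k"
  by (simp_all add: coord_def stack_def vectorize_def)

lemma linear_coord: "linear coord"
  by (rule linearI) (auto simp: vec_eq_iff coord_def stack_def vectorize_def split: sum.split)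

lemmas coord_simps = linear_add[OF linear_coord] linear_diff[OF linear_coord]
  linear_scale[OF linear_coord] linear_0[OF linear_coord]

lemma sum_UNIV_Plus:
  fixes f :: "'a::finite + 'b::finite \<Rightarrow> 'c::comm_monoid_add"
  shows "sum f UNIV = (\<Sum>a\<in>UNIV. f (Inl a)) + (\<Sum>b\<in>UNIV. f (Inr b))"
  using sum.Plus[of UNIV UNIV f] by (simp add: comp_def)

text \<open>Flattening is an isometry, so a bound on the distance of parameter pairs is a bound on
  the vectors to which the block matrix is applied.\<close>

lemma inner_coord: "coord u \<bullet> coord v = u \<bullet> v"
proof -
  have "(\<Sum>k\<in>UNIV. coord u $ Inl k * coord v $ Inl k) = fst u \<bullet> fst v"
    unfolding UNIV_Times_UNIV[symmetric] sum.cartesian_product'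
    by (simp add: inner_vec_def) (rule sum.swap)
  then show ?thesis
    by (simp add: inner_vec_def[of "coord u"] sum_UNIV_Plus inner_prod_def inner_vec_def[of "snd u"])
qed

lemma norm_coord: "norm (coord u) = norm u"
  by (simp add: norm_eq_sqrt_inner inner_coord)

text \<open>The weights are parameters so that the limiting penalty, the penalty at stage
  \<open>n\<close> and each norm alone are instances of one function.\<close>

definition penalty :: "real \<Rightarrow> real \<Rightarrow> (real^'q^'m) \<times> (real^'p) \<Rightarrow> real" where
  "penalty r l \<theta> = r * nuclear_norm (fst \<theta>) + l * l1_norm (snd \<theta>)"

lemma convex_on_linear_compose:
  assumes "convex_on UNIV f" "linear g"
  shows "convex_on UNIV (\<lambda>x. f (g x))"
  using assms unfolding convex_on_def by (simp add: linear_add linear_scale)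

lemma convex_on_penalty:
  assumes "r \<ge> 0" "l \<ge> 0"
  shows "convex_on UNIV (penalty r l)"
  unfolding penalty_def
  by (intro convex_on_add convex_on_cmul assms
      convex_on_linear_compose[OF convex_on_nuclear_norm linear_fst]
      convex_on_linear_compose[OF convex_on_l1_norm linear_snd])

lemma penalty_nonneg:
  assumes "r \<ge> 0" "l \<ge> 0"
  shows "penalty r l \<theta> \<ge> 0"
  using assms by (simp add: penalty_def nuclear_norm_nonneg l1_norm_nonneg)

lemma Zlim_eq:
  fixes B :: "real^'q^'m" and \<gamma> :: "real^'p"
  shows "Zlim S B \<gamma> r l \<theta> = coord (\<theta> - (B, \<gamma>)) \<bullet> (S *v coord (\<theta> - (B, \<gamma>))) + penalty r l \<theta>"
  by (cases \<theta>) (simp add: Zlim_def coord_def penalty_def)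

text \<open>The parallelogram identity at the midpoint of \<open>\<theta>\<close> and the minimizer.\<close>

lemma Zlim_quadratic_growth:
  fixes S :: "real^(('q::finite \<times> 'm::finite) + 'p::finite)^(('q \<times> 'm) + 'p)"
  assumes coercive: "\<And>v. c * (norm v)\<^sup>2 \<le> v \<bullet> (S *v v)" and pen: "r \<ge> 0" "l \<ge> 0"
    and min: "is_minimizer (Zlim S B \<gamma> r l) \<theta>\<^sub>0"
  shows "Zlim S B \<gamma> r l \<theta>\<^sub>0 + c / 2 * (norm (\<theta> - \<theta>\<^sub>0))\<^sup>2 \<le> Zlim S B \<gamma> r l \<theta>"
proof -
  define q where "q w = coord w \<bullet> (S *v coord w)" for w :: "(real^'q^'m) \<times> (real^'p)"
  let ?P = "penalty r l" and ?F = "Zlim S B \<gamma> r l"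
  have F: "?F x = q (x - (B, \<gamma>)) + ?P x" for x by (simp add: Zlim_eq q_def)
  define mid where "mid = (1/2) *\<^sub>R \<theta>\<^sub>0 + (1/2) *\<^sub>R \<theta>"
  define u where "u = \<theta>\<^sub>0 - (B, \<gamma>)"
  define v where "v = \<theta> - (B, \<gamma>)"
  have par: "q ((1/2) *\<^sub>R u + (1/2) *\<^sub>R v) = q u / 2 + q v / 2 - q (v - u) / 4"
    unfolding q_def
    by (simp add: coord_simps matrix_vector_right_distrib
        matrix_vector_mult_diff_distrib matrix_vector_mult_scaleR inner_add_left inner_add_right
        inner_diff_left inner_diff_right field_simps)
  have "(B, \<gamma>) = (1/2) *\<^sub>R (B, \<gamma>) + (1/2) *\<^sub>R (B, \<gamma>)"
    by (simp flip: scaleR_add_left)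
  then have mid': "mid - (B, \<gamma>) = (1/2) *\<^sub>R u + (1/2) *\<^sub>R v"
    by (simp add: mid_def u_def v_def algebra_simps)
  have "?P mid \<le> (1 - 1/2) * ?P \<theta>\<^sub>0 + 1/2 * ?P \<theta>"
    using convex_onD[OF convex_on_penalty[OF pen], of "1/2" \<theta>\<^sub>0 \<theta>] by (simp add: mid_def)
  moreover have "?F \<theta>\<^sub>0 \<le> ?F mid"
    using min unfolding is_arg_min_linorder by blast
  \<comment> \<open>Comparison of the minimizer with the midpoint: the parallelogram defect
    \<open>q (v - u) / 4\<close> becomes, after rearranging, a growth of at least
    \<open>q (v - u) / 2\<close>.\<close>
  ultimately have "?F \<theta>\<^sub>0 \<le> ?F \<theta>\<^sub>0 / 2 + ?F \<theta> / 2 - q (v - u) / 4"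
    unfolding F mid' par by (simp add: u_def v_def add_divide_distrib)
  moreover have "c * (norm (\<theta> - \<theta>\<^sub>0))\<^sup>2 \<le> q (v - u)"
    using coercive[of "coord (v - u)"] by (simp add: q_def norm_coord u_def v_def)
  ultimately show ?thesis by simp
qed

text \<open>A finite convex function on a Euclidean space is continuous. Convexity is available for
  nonnegative weights, so the two norms are treated separately and then recombined with weights of
  any sign.\<close>

lemma continuous_on_penalty: "continuous_on UNIV (penalty r l)"
proof -
  have "continuous_on UNIV (\<lambda>\<theta>. penalty 1 0 \<theta>)" "continuous_on UNIV (\<lambda>\<theta>. penalty 0 1 \<theta>)"
    by (intro convex_on_continuous convex_on_penalty; simp)+
  then have "continuous_on UNIV (\<lambda>\<theta>. r * penalty 1 0 \<theta> + l * penalty 0 1 \<theta>)"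
    by (intro continuous_intros)
  then show ?thesis by (simp add: penalty_def[abs_def])
qed

text \<open>Existence follows from compactness of a large ball around \<open>(B, \<gamma>)\<close>,
  outside which the coercive quadratic part exceeds the value at the centre. Uniqueness follows from
  quadratic growth.\<close>

lemma Zlim_ex1_minimizer:
  fixes S :: "real^(('q::finite \<times> 'm::finite) + 'p::finite)^(('q \<times> 'm) + 'p)" and B :: "real^'q^'m" and \<gamma> :: "real^'p"
  assumes S: "pos_def S" and pen: "r \<ge> 0" "l \<ge> 0"
  shows "\<exists>!\<theta>. is_minimizer (Zlim S B \<gamma> r l) \<theta>"
proof -
  let ?F = "Zlim S B \<gamma> r l" and ?\<theta>\<^sub>0 = "(B, \<gamma>)"
  obtain c where c: "c > 0" "\<And>v. c * (norm v)\<^sup>2 \<le> v \<bullet> (S *v v)"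
    using pos_def_coercive[OF S] by blast
  \<comment> \<open>The quotient gives \<open>?F (B, \<gamma>) \<le> c * R\<close>; the added 1
    ensures \<open>R \<ge> 1\<close>, so that a norm above \<open>R\<close> is at most its own
    square.\<close>
  define R where "R = ?F ?\<theta>\<^sub>0 / c + 1"
  have F0: "?F ?\<theta>\<^sub>0 \<ge> 0"
    using penalty_nonneg[OF pen] by (simp add: Zlim_eq coord_simps)
  then have R: "R \<ge> 1" using c(1) by (simp add: R_def)
  have "continuous_on (cball ?\<theta>\<^sub>0 R) (\<lambda>\<theta>. coord (\<theta> - ?\<theta>\<^sub>0) \<bullet> (S *v coord (\<theta> - ?\<theta>\<^sub>0)) + penalty r l \<theta>)"
    by (intro continuous_intros continuous_on_subset[OF continuous_on_penalty]
        linear_continuous_on_compose[OF _ matrix_vector_mul_linear]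
        linear_continuous_on_compose[OF _ linear_coord]) auto
  then have cont: "continuous_on (cball ?\<theta>\<^sub>0 R) ?F"
    by (simp add: Zlim_eq[abs_def])
  have "cball ?\<theta>\<^sub>0 R \<noteq> {}" using R by auto
  then obtain \<theta> where \<theta>: "\<theta> \<in> cball ?\<theta>\<^sub>0 R" "\<And>x. x \<in> cball ?\<theta>\<^sub>0 R \<Longrightarrow> ?F \<theta> \<le> ?F x"
    using continuous_attains_inf[OF compact_cball _ cont] by blast
  have "?F \<theta> \<le> ?F x" for x
  proof (cases "x \<in> cball ?\<theta>\<^sub>0 R")
    case False
    then have far: "norm (x - ?\<theta>\<^sub>0) > R" by (simp add: dist_norm norm_minus_commute)
    have "?F \<theta> \<le> ?F ?\<theta>\<^sub>0" using \<theta>(2) R by simp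
    also have "\<dots> \<le> c * R" using c(1) by (simp add: R_def algebra_simps)
    also have "\<dots> \<le> c * (norm (x - ?\<theta>\<^sub>0))\<^sup>2"
      using far R c(1) self_le_power[of "norm (x - ?\<theta>\<^sub>0)" 2] by simp
    also have "\<dots> \<le> ?F x"
      using c(2)[of "coord (x - ?\<theta>\<^sub>0)"] penalty_nonneg[OF pen, of x]
      by (simp add: Zlim_eq norm_coord)
    finally show ?thesis .
  qed (rule \<theta>(2))
  then have min: "is_minimizer ?F \<theta>" unfolding is_arg_min_linorder by blast
  moreover have "\<theta>' = \<theta>" if "is_minimizer ?F \<theta>'" for \<theta>'
  proof -
    have "?F \<theta> + c / 2 * (norm (\<theta>' - \<theta>))\<^sup>2 \<le> ?F \<theta>'"
      by (rule Zlim_quadratic_growth[OF c(2) pen min])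
    moreover have "?F \<theta>' \<le> ?F \<theta>" using that unfolding is_arg_min_linorder by blast
    ultimately have "c / 2 * (norm (\<theta>' - \<theta>))\<^sup>2 \<le> 0" by linarith
    then show ?thesis using c(1) by (simp add: mult_le_0_iff)
  qed
  ultimately show ?thesis by blast
qed

subsection \<open>Averages of Gaussian noise\<close>

text \<open>On the diagonal this is the variance of a centred normal variable; off the diagonal
  independence factors the expectation into a product of zero means.\<close>

lemma (in prob_space) indep_normal_product_moments:
  assumes indep: "indep_vars (\<lambda>_. borel) \<epsilon> I" and \<sigma>: "\<sigma> > 0"
    and normal: "\<And>i. i \<in> I \<Longrightarrow> distributed M lborel (\<epsilon> i) (normal_density 0 \<sigma>)"
    and ij: "i \<in> I" "j \<in> I"
  shows "integrable M (\<lambda>\<omega>. \<epsilon> i \<omega> * \<epsilon> j \<omega>)"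
    and "expectation (\<lambda>\<omega>. \<epsilon> i \<omega> * \<epsilon> j \<omega>) = (if i = j then \<sigma>\<^sup>2 else 0)"
proof -
  have int: "integrable M (\<epsilon> k)" if "k \<in> I" for k
    using distributed_integrable_var[OF normal[OF that]] integrable_normal_moment_nz_1[OF \<sigma>, of 0]
    by simp
  have mean: "expectation (\<epsilon> k) = 0" if "k \<in> I" for k
    by (rule normal_distributed_expectation[OF \<sigma> normal[OF that]])
  have int2: "integrable M (\<lambda>\<omega>. \<epsilon> k \<omega> * \<epsilon> k \<omega>)" if "k \<in> I" for k
    using distributed_integrable[OF normal[OF that], of "\<lambda>x. x\<^sup>2"]
      integrable_normal_moment[OF \<sigma>, of 0 2] by (simp add: power2_eq_square)
  have "integrable M (\<lambda>\<omega>. \<epsilon> i \<omega> * \<epsilon> j \<omega>) \<and>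
      expectation (\<lambda>\<omega>. \<epsilon> i \<omega> * \<epsilon> j \<omega>) = (if i = j then \<sigma>\<^sup>2 else 0)"
  proof (cases "i = j")
    case True
    have "expectation (\<lambda>\<omega>. (\<epsilon> i \<omega>)\<^sup>2) = \<sigma>\<^sup>2"
      using normal_distributed_variance[OF \<sigma> normal[OF ij(1)]] mean[OF ij(1)] by simp
    then show ?thesis using True int2[OF ij(1)] by (simp add: power2_eq_square)
  next
    case False
    have "indep_vars (\<lambda>_. borel) \<epsilon> {i, j}"
      by (rule indep_vars_subset[OF indep]) (use ij in auto)
    then have "integrable M (\<lambda>\<omega>. \<Prod>k\<in>{i, j}. \<epsilon> k \<omega>)"
        "expectation (\<lambda>\<omega>. \<Prod>k\<in>{i, j}. \<epsilon> k \<omega>) = (\<Prod>k\<in>{i, j}. expectation (\<epsilon> k))"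
      using int ij by (intro indep_vars_integrable indep_vars_lebesgue_integral; auto)+
    then show ?thesis using False mean ij by simp
  qed
  then show "integrable M (\<lambda>\<omega>. \<epsilon> i \<omega> * \<epsilon> j \<omega>)"
    and "expectation (\<lambda>\<omega>. \<epsilon> i \<omega> * \<epsilon> j \<omega>) = (if i = j then \<sigma>\<^sup>2 else 0)" by blast+
qed

text \<open>Expanding the squared norm gives a double sum in which only the diagonal has nonzero
  expectation.\<close>

lemma (in prob_space) normal_noise_sum_second_moment:
  fixes \<xi> :: "'i \<Rightarrow> 'b::real_inner"
  assumes indep: "indep_vars (\<lambda>_. borel) \<epsilon> I" and \<sigma>: "\<sigma> > 0"
    and normal: "\<And>i. i \<in> I \<Longrightarrow> distributed M lborel (\<epsilon> i) (normal_density 0 \<sigma>)"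
    and J: "finite J" "J \<subseteq> I"
  shows "integrable M (\<lambda>\<omega>. (norm (\<Sum>i\<in>J. \<epsilon> i \<omega> *\<^sub>R \<xi> i))\<^sup>2)"
    and "expectation (\<lambda>\<omega>. (norm (\<Sum>i\<in>J. \<epsilon> i \<omega> *\<^sub>R \<xi> i))\<^sup>2) = \<sigma>\<^sup>2 * (\<Sum>i\<in>J. (norm (\<xi> i))\<^sup>2)"
proof -
  note mom = indep_normal_product_moments[OF indep \<sigma> normal]
  have eq: "(norm (\<Sum>i\<in>J. \<epsilon> i \<omega> *\<^sub>R \<xi> i))\<^sup>2 = (\<Sum>i\<in>J. \<Sum>j\<in>J. (\<epsilon> i \<omega> * \<epsilon> j \<omega>) * (\<xi> i \<bullet> \<xi> j))" for \<omega>
    unfolding power2_norm_eq_inner inner_sum_left inner_sum_right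
    by (intro sum.cong refl) (simp add: inner_commute mult.commute mult.left_commute)
  have int: "integrable M (\<lambda>\<omega>. (\<epsilon> i \<omega> * \<epsilon> j \<omega>) * (\<xi> i \<bullet> \<xi> j))" if "i \<in> J" "j \<in> J" for i j
    by (intro integrable_mult_left mom(1)) (use that J in auto)
  then show "integrable M (\<lambda>\<omega>. (norm (\<Sum>i\<in>J. \<epsilon> i \<omega> *\<^sub>R \<xi> i))\<^sup>2)"
    unfolding eq by (intro Bochner_Integration.integrable_sum)
  have "expectation (\<lambda>\<omega>. (norm (\<Sum>i\<in>J. \<epsilon> i \<omega> *\<^sub>R \<xi> i))\<^sup>2) =
      (\<Sum>i\<in>J. \<Sum>j\<in>J. expectation (\<lambda>\<omega>. \<epsilon> i \<omega> * \<epsilon> j \<omega>) * (\<xi> i \<bullet> \<xi> j))"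
    unfolding eq using int by (simp add: Bochner_Integration.integral_sum Bochner_Integration.integrable_sum)
  also have "\<dots> = (\<Sum>i\<in>J. \<Sum>j\<in>J. if j = i then \<sigma>\<^sup>2 * (\<xi> i \<bullet> \<xi> i) else 0)"
    using J by (intro sum.cong refl) (auto simp: mom(2) subset_iff)
  also have "\<dots> = \<sigma>\<^sup>2 * (\<Sum>i\<in>J. (norm (\<xi> i))\<^sup>2)"
    using J(1) by (simp add: sum_distrib_left power2_norm_eq_inner)
  finally show "expectation (\<lambda>\<omega>. (norm (\<Sum>i\<in>J. \<epsilon> i \<omega> *\<^sub>R \<xi> i))\<^sup>2) = \<sigma>\<^sup>2 * (\<Sum>i\<in>J. (norm (\<xi> i))\<^sup>2)" .
qed

text \<open>A weighted weak law: Markov's inequality for the squared norm gives a bound of order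
  \<open>1 / n\<close>, because the averages of the squared weights converge. Measurability of the
  event is recorded for the later use of monotonicity of the measure.\<close>

lemma (in prob_space) normal_noise_average_tendsto_zero:
  fixes \<xi> :: "nat \<Rightarrow> 'b::euclidean_space"
  assumes indep: "indep_vars (\<lambda>_. borel) \<epsilon> {1..}" and \<sigma>: "\<sigma> > 0"
    and normal: "\<And>i. i \<ge> 1 \<Longrightarrow> distributed M lborel (\<epsilon> i) (normal_density 0 \<sigma>)"
    and lim: "(\<lambda>n. (\<Sum>i=1..n. (norm (\<xi> i))\<^sup>2) / real n) \<longlonglongrightarrow> L"
    and \<tau>: "\<tau> > 0"
  shows "{\<omega> \<in> space M. norm ((1 / real n) *\<^sub>R (\<Sum>i=1..n. \<epsilon> i \<omega> *\<^sub>R \<xi> i)) \<ge> \<tau>} \<in> events"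
    and "(\<lambda>n. prob {\<omega> \<in> space M. norm ((1 / real n) *\<^sub>R (\<Sum>i=1..n. \<epsilon> i \<omega> *\<^sub>R \<xi> i)) \<ge> \<tau>}) \<longlonglongrightarrow> 0"
proof -
  let ?g = "\<lambda>n \<omega>. (1 / real n) *\<^sub>R (\<Sum>i=1..n. \<epsilon> i \<omega> *\<^sub>R \<xi> i)"
  have [measurable]: "random_variable borel (\<epsilon> i)" if "i \<ge> 1" for i
    using distributed_measurable[OF normal[OF that]] by simp
  have [measurable]: "random_variable borel (?g n)" for n
    by (intro borel_measurable_scaleR borel_measurable_sum borel_measurable_const) auto
  show ev: "{\<omega> \<in> space M. norm (?g n \<omega>) \<ge> \<tau>} \<in> events" for n
    by measurable
  \<comment> \<open>For \<open>n = 0\<close> division by zero makes the average and the bound both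
    0, so the estimate holds for every \<open>n\<close>.\<close>
  let ?b = "\<lambda>n. \<sigma>\<^sup>2 / \<tau>\<^sup>2 * ((\<Sum>i=1..n. (norm (\<xi> i))\<^sup>2) / real n * (1 / real n))"
  have bound: "prob {\<omega> \<in> space M. norm (?g n \<omega>) \<ge> \<tau>} \<le> ?b n" for n
  proof -
    have sq: "(norm (?g n \<omega>))\<^sup>2 = (1 / real n)\<^sup>2 * (norm (\<Sum>i=1..n. \<epsilon> i \<omega> *\<^sub>R \<xi> i))\<^sup>2" for \<omega>
      by (simp add: power_mult_distrib power_divide)
    note mom = normal_noise_sum_second_moment[OF indep \<sigma>, of "{1..n}" \<xi>]
    have int: "integrable M (\<lambda>\<omega>. (norm (?g n \<omega>))\<^sup>2)"
      unfolding sq by (intro integrable_mult_right mom(1)) (auto intro: normal)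
    have "{\<omega> \<in> space M. norm (?g n \<omega>) \<ge> \<tau>} = {\<omega> \<in> space M. (norm (?g n \<omega>))\<^sup>2 \<ge> \<tau>\<^sup>2}"
      using \<tau> by (auto simp: abs_le_square_iff[symmetric] simp del: norm_scaleR)
    also have "prob \<dots> \<le> expectation (\<lambda>\<omega>. (norm (?g n \<omega>))\<^sup>2) / \<tau>\<^sup>2"
      using int \<tau> by (intro integral_Markov_inequality_measure[of _ _ "{}"]) auto
    also have "\<dots> = ?b n"
      unfolding sq using mom(2) normal by (simp add: power2_eq_square)
    finally show ?thesis .
  qed
  have lim_b: "?b \<longlonglongrightarrow> 0"
    using tendsto_mult[OF tendsto_const[of "\<sigma>\<^sup>2 / \<tau>\<^sup>2"] tendsto_mult[OF lim lim_1_over_n]] by simp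
  show "(\<lambda>n. prob {\<omega> \<in> space M. norm (?g n \<omega>) \<ge> \<tau>}) \<longlonglongrightarrow> 0"
    by (rule tendsto_sandwich[OF _ _ tendsto_const lim_b]) (use bound in auto)
qed

subsection \<open>Convergence of the estimator\<close>

lemma outer_product_vector_mult: "outer_product u v *v w = (v \<bullet> w) *\<^sub>R u"
  by (simp add: vec_eq_iff matrix_vector_mult_def outer_product_def inner_vec_def
      sum_distrib_left sum_distrib_right mult_ac)

lemma sum_matrix_vector_mult: "(\<Sum>i\<in>I. A i) *v w = (\<Sum>i\<in>I. A i *v w)"
  for w :: "real^'n"
  by (induction I rule: infinite_finite_induct) (auto simp: matrix_vector_mult_add_rdistrib)

definition second_moment :: "(nat \<Rightarrow> real^'n) \<Rightarrow> nat \<Rightarrow> real^'n^'n" where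
  "second_moment \<xi> n = (1 / real n) *\<^sub>R (\<Sum>i=1..n. outer_product (\<xi> i) (\<xi> i))"

lemma inner_second_moment:
  "w \<bullet> (second_moment \<xi> n *v w) = (\<Sum>i=1..n. (\<xi> i \<bullet> w)\<^sup>2) / real n"
  unfolding second_moment_def
  by (simp add: sum_matrix_vector_mult outer_product_vector_mult inner_sum_right inner_commute
      power2_eq_square flip: scaleR_matrix_vector_assoc)

lemma second_moment_nth:
  "second_moment \<xi> n $ i $ j = (1 / real n) * (\<Sum>k=1..n. \<xi> k $ i * \<xi> k $ j)"
  by (simp add: second_moment_def outer_product_def)

text \<open>Through this identity, convergence of the second moment matrices supplies the hypothesis
  on averaged squared norms in the weak law.\<close>

lemma trace_second_moment:
  "(\<Sum>i=1..n. (norm (\<xi> i))\<^sup>2) / real n = trace (second_moment \<xi> n)"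
proof -
  have "(\<Sum>i=1..n. (norm (\<xi> i))\<^sup>2) = (\<Sum>k\<in>UNIV. \<Sum>i=1..n. \<xi> i $ k * \<xi> i $ k)"
    unfolding power2_norm_eq_inner inner_vec_def by (subst sum.swap) simp
  then show ?thesis
    by (simp add: trace_def second_moment_nth sum_divide_distrib)
qed

lemma second_moment_coord_tendsto:
  fixes X :: "nat \<Rightarrow> real^'q^'m" and z :: "nat \<Rightarrow> real^'p"
  assumes C: "(\<lambda>n. (1 / real n) *\<^sub>R (\<Sum>i=1..n. outer_product (vectorize (X i)) (vectorize (X i)))) \<longlonglongrightarrow> C"
    and D: "(\<lambda>n. (1 / real n) *\<^sub>R (\<Sum>i=1..n. outer_product (z i) (z i))) \<longlonglongrightarrow> D"
    and H: "(\<lambda>n. (1 / real n) *\<^sub>R (\<Sum>i=1..n. outer_product (vectorize (X i)) (z i))) \<longlonglongrightarrow> H"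
  shows "second_moment (\<lambda>i. coord (X i, z i)) \<longlonglongrightarrow> block_mat C H (transpose H) D"
proof (intro vec_tendstoI)
  fix s t
  have C': "(\<lambda>n. (1 / real n) * (\<Sum>i=1..n. vectorize (X i) $ a * vectorize (X i) $ b)) \<longlonglongrightarrow> C $ a $ b" for a b
    using tendsto_vec_nth[OF tendsto_vec_nth[OF C, of a], of b] by (simp add: outer_product_def)
  have D': "(\<lambda>n. (1 / real n) * (\<Sum>i=1..n. z i $ a * z i $ b)) \<longlonglongrightarrow> D $ a $ b" for a b
    using tendsto_vec_nth[OF tendsto_vec_nth[OF D, of a], of b] by (simp add: outer_product_def)
  have H': "(\<lambda>n. (1 / real n) * (\<Sum>i=1..n. vectorize (X i) $ a * z i $ b)) \<longlonglongrightarrow> H $ a $ b" for a b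
    using tendsto_vec_nth[OF tendsto_vec_nth[OF H, of a], of b] by (simp add: outer_product_def)
  \<comment> \<open>Convergence is entrywise, with one case per block. In the lower left block the
    factors appear in the opposite order and are commuted to match the limit
    \<open>H\<close>.\<close>
  show "(\<lambda>n. second_moment (\<lambda>i. coord (X i, z i)) n $ s $ t) \<longlonglongrightarrow> block_mat C H (transpose H) D $ s $ t"
    using C' D' H'
    by (cases s; cases t) (simp_all add: second_moment_nth coord_def stack_def block_mat_def
        transpose_def mult.commute[of "z _ $ _" "vectorize _ $ _"])
qed

text \<open>Under the model the residual at \<open>\<theta>\<close> is
  \<open>e i - \<xi> i \<bullet> w\<close> with \<open>w = coord (\<theta> - (B, \<gamma>))\<close>.
  Squaring separates a term free of \<open>\<theta>\<close>, a quadratic form and a term linear in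
  the noise.\<close>

lemma Zn_expand:
  fixes B :: "real^'q^'m" and \<gamma> :: "real^'p"
  assumes "\<And>i. i \<ge> 1 \<Longrightarrow> y i = mat_inner (X i) B + z i \<bullet> \<gamma> + e i"
  defines "\<xi> \<equiv> \<lambda>i. coord (X i, z i)"
  shows "Zn X z y \<rho> lam n \<theta> = (\<Sum>i=1..n. (e i)\<^sup>2) / real n
    + coord (\<theta> - (B, \<gamma>)) \<bullet> (second_moment \<xi> n *v coord (\<theta> - (B, \<gamma>)))
    - 2 * (((1 / real n) *\<^sub>R (\<Sum>i=1..n. e i *\<^sub>R \<xi> i)) \<bullet> coord (\<theta> - (B, \<gamma>)))
    + penalty (\<rho> n / real n) (lam n / real n) \<theta>"
proof (cases \<theta>)
  case (Pair U \<beta>)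
  let ?w = "coord (\<theta> - (B, \<gamma>))"
  have res: "y i - mat_inner (X i) U - z i \<bullet> \<beta> = e i - \<xi> i \<bullet> ?w" if "i \<ge> 1" for i
    using assms(1)[OF that]
    by (simp add: Pair \<xi>_def inner_coord mat_inner_eq_inner inner_diff_right)
  have sq: "(y i - mat_inner (X i) U - z i \<bullet> \<beta>)\<^sup>2 = (e i)\<^sup>2 + (\<xi> i \<bullet> ?w)\<^sup>2 - 2 * (e i * (\<xi> i \<bullet> ?w))"
    if "i \<ge> 1" for i
    unfolding res[OF that] by (simp add: power2_diff)
  have "(\<Sum>i=1..n. (y i - mat_inner (X i) U - z i \<bullet> \<beta>)\<^sup>2) =
      (\<Sum>i=1..n. (e i)\<^sup>2 + (\<xi> i \<bullet> ?w)\<^sup>2 - 2 * (e i * (\<xi> i \<bullet> ?w)))"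
    by (rule sum.cong[OF refl sq]) simp
  also have "\<dots> = (\<Sum>i=1..n. (e i)\<^sup>2) + (\<Sum>i=1..n. (\<xi> i \<bullet> ?w)\<^sup>2) - 2 * (\<Sum>i=1..n. e i * (\<xi> i \<bullet> ?w))"
    by (simp add: sum.distrib sum_subtractf sum_distrib_left)
  finally show ?thesis
    by (simp add: Zn_def Pair penalty_def inner_second_moment inner_sum_left
        add_divide_distrib diff_divide_distrib)
qed

section \<open>Convexity of the empirical objective and its closeness to the limit\<close>

lemma convex_on_square_affine:
  fixes x :: "'a::real_inner"
  shows "convex_on UNIV (\<lambda>\<theta>. (a - x \<bullet> \<theta>)\<^sup>2)"
proof (rule convex_onI)
  fix t :: real and u v :: 'a
  assume t: "0 < t" "t < 1"
  define p q where "p = a - x \<bullet> u" and "q = a - x \<bullet> v"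
  have "a - x \<bullet> ((1 - t) *\<^sub>R u + t *\<^sub>R v) = (1 - t) * p + t * q"
    by (simp add: p_def q_def inner_add_right algebra_simps)
  moreover have "(1 - t) * p\<^sup>2 + t * q\<^sup>2 - ((1 - t) * p + t * q)\<^sup>2 = t * (1 - t) * (p - q)\<^sup>2"
    by algebra
  moreover have "t * (1 - t) * (p - q)\<^sup>2 \<ge> 0" using t by simp
  ultimately show "(a - x \<bullet> ((1 - t) *\<^sub>R u + t *\<^sub>R v))\<^sup>2 \<le> (1 - t) * (a - x \<bullet> u)\<^sup>2 + t * (a - x \<bullet> v)\<^sup>2"
    by (simp add: p_def q_def)
qed simp

lemma convex_on_Zn:
  fixes X :: "nat \<Rightarrow> real^'q^'m" and z :: "nat \<Rightarrow> real^'p"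
  assumes "\<rho> n \<ge> 0" "lam n \<ge> 0"
  shows "convex_on UNIV (Zn X z y \<rho> lam n)"
proof -
  have "convex_on UNIV (\<lambda>\<theta>. \<Sum>i\<in>I. (y i - (X i, z i) \<bullet> \<theta>)\<^sup>2)" for I
  proof (induction I rule: infinite_finite_induct)
    case (insert i I)
    show ?case
      unfolding sum.insert[OF insert.hyps] by (rule convex_on_add[OF convex_on_square_affine insert.IH])
  qed (simp_all add: convex_on_const)
  then have "convex_on UNIV (\<lambda>\<theta>. 1 / real n * (\<Sum>i=1..n. (y i - (X i, z i) \<bullet> \<theta>)\<^sup>2)
      + penalty (\<rho> n / real n) (lam n / real n) \<theta>)"
    using assms by (intro convex_on_add convex_on_cmul convex_on_penalty) auto
  moreover have "Zn X z y \<rho> lam n = (\<lambda>\<theta>. 1 / real n * (\<Sum>i=1..n. (y i - (X i, z i) \<bullet> \<theta>)\<^sup>2)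
      + penalty (\<rho> n / real n) (lam n / real n) \<theta>)"
    by (auto simp: Zn_def penalty_def mat_inner_eq_inner diff_diff_eq)
  ultimately show ?thesis by simp
qed

text \<open>A bound for one realization \<open>e\<close> of the noise. The three sources of error
  are the noise term, the deviation of the second moments and the deviation of the penalty weights.
  The mean of the squared errors is added to the limit instead of being estimated, as it does not
  depend on \<open>\<theta>\<close>.\<close>

lemma Zn_close_to_Zlim:
  fixes B :: "real^'q^'m" and \<gamma> :: "real^'p"
  assumes model: "\<And>i. i \<ge> 1 \<Longrightarrow> y i = mat_inner (X i) B + z i \<bullet> \<gamma> + e i"
    and noise: "norm ((1 / real n) *\<^sub>R (\<Sum>i=1..n. e i *\<^sub>R coord (X i, z i))) \<le> \<tau>"
    and R: "norm (\<theta> - (B, \<gamma>)) \<le> R" and K: "nuclear_norm (fst \<theta>) \<le> K" "l1_norm (snd \<theta>) \<le> K"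
  shows "\<bar>Zn X z y \<rho> lam n \<theta> - (Zlim S B \<gamma> \<rho>0 lam0 \<theta> + (\<Sum>i=1..n. (e i)\<^sup>2) / real n)\<bar>
    \<le> 2 * (\<tau> * R) + (norm (second_moment (\<lambda>i. coord (X i, z i)) n - S) * R\<^sup>2
      + (\<bar>\<rho> n / real n - \<rho>0\<bar> * K + \<bar>lam n / real n - lam0\<bar> * K))"
proof -
  define w where "w = coord (\<theta> - (B, \<gamma>))"
  define g where "g = (1 / real n) *\<^sub>R (\<Sum>i=1..n. e i *\<^sub>R coord (X i, z i))"
  define A where "A = second_moment (\<lambda>i. coord (X i, z i)) n - S"
  have w: "norm w \<le> R" using R by (simp add: w_def norm_coord)
  have "R \<ge> 0" using w norm_ge_zero order_trans by blast
  have "\<tau> \<ge> 0" using noise norm_ge_zero order_trans by blast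
  have "\<bar>g \<bullet> w\<bar> \<le> norm g * norm w" by (rule Cauchy_Schwarz_ineq2)
  also have "\<dots> \<le> \<tau> * R"
    using noise w \<open>\<tau> \<ge> 0\<close> unfolding g_def by (intro mult_mono) auto
  finally have 1: "\<bar>g \<bullet> w\<bar> \<le> \<tau> * R" .
  have "\<bar>w \<bullet> (A *v w)\<bar> \<le> norm w * norm (A *v w)" by (rule Cauchy_Schwarz_ineq2)
  also have "\<dots> \<le> norm w * (norm A * norm w)"
    by (intro mult_left_mono norm_matrix_vector_mult_le) auto
  also have "\<dots> = norm A * (norm w)\<^sup>2" by (simp add: power2_eq_square)
  also have "\<dots> \<le> norm A * R\<^sup>2"
    using w by (intro mult_left_mono power_mono) auto
  finally have 2: "\<bar>w \<bullet> (A *v w)\<bar> \<le> norm A * R\<^sup>2" .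
  have 3: "\<bar>(\<rho> n / real n - \<rho>0) * nuclear_norm (fst \<theta>)\<bar> \<le> \<bar>\<rho> n / real n - \<rho>0\<bar> * K"
    using K(1) nuclear_norm_nonneg[of "fst \<theta>"] by (simp only: abs_mult) (intro mult_left_mono; simp)
  have 4: "\<bar>(lam n / real n - lam0) * l1_norm (snd \<theta>)\<bar> \<le> \<bar>lam n / real n - lam0\<bar> * K"
    using K(2) l1_norm_nonneg[of "snd \<theta>"] by (simp only: abs_mult) (intro mult_left_mono; simp)
  have expand: "Zn X z y \<rho> lam n \<theta> = (\<Sum>i=1..n. (e i)\<^sup>2) / real n
      + w \<bullet> (second_moment (\<lambda>i. coord (X i, z i)) n *v w) - 2 * (g \<bullet> w)
      + penalty (\<rho> n / real n) (lam n / real n) \<theta>"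
    unfolding w_def g_def by (rule Zn_expand) (rule model)
  have "Zn X z y \<rho> lam n \<theta> - (Zlim S B \<gamma> \<rho>0 lam0 \<theta> + (\<Sum>i=1..n. (e i)\<^sup>2) / real n) =
      w \<bullet> (A *v w) - 2 * (g \<bullet> w) + (\<rho> n / real n - \<rho>0) * nuclear_norm (fst \<theta>)
      + (lam n / real n - lam0) * l1_norm (snd \<theta>)"
    unfolding expand Zlim_eq A_def penalty_def w_def[symmetric]
    by (simp only: matrix_vector_mult_diff_rdistrib inner_diff_right left_diff_distrib)
  then show ?thesis using 1 2 3 4 unfolding A_def by linarith
qed

text \<open>Randomness enters through a single event: for large \<open>n\<close>, every outcome
  whose noise average has norm at most \<open>\<tau>\<close> is handled by the deterministic
  comparison.\<close>

lemma estimator_tendsto_in_prob: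
  fixes X :: "nat \<Rightarrow> real^'q^'m" and z :: "nat \<Rightarrow> real^'p" and B :: "real^'q^'m" and \<gamma> :: "real^'p"
  assumes prob_M: "prob_space M" and \<sigma>: "\<sigma> > 0"
    and indep: "prob_space.indep_vars M (\<lambda>_. borel) \<epsilon> {1..}"
    and normal: "\<And>i. i \<ge> 1 \<Longrightarrow> distributed M lborel (\<epsilon> i) (normal_density 0 \<sigma>)"
    and model: "\<And>i \<omega>. i \<ge> 1 \<Longrightarrow> \<omega> \<in> space M \<Longrightarrow> y i \<omega> = mat_inner (X i) B + z i \<bullet> \<gamma> + \<epsilon> i \<omega>"
    and pen: "\<And>n. n \<ge> 1 \<Longrightarrow> \<rho> n \<ge> 0" "\<And>n. n \<ge> 1 \<Longrightarrow> lam n \<ge> 0"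
    and estimator: "\<And>n \<omega>. n \<ge> 1 \<Longrightarrow> \<omega> \<in> space M \<Longrightarrow>
      is_minimizer (Zn X z (\<lambda>i. y i \<omega>) \<rho> lam n) (\<theta>hat n \<omega>)"
    and S_lim: "second_moment (\<lambda>i. coord (X i, z i)) \<longlonglongrightarrow> S" and S: "pos_def S"
    and rho: "(\<lambda>n. \<rho> n / real n) \<longlonglongrightarrow> \<rho>0" "\<rho>0 \<ge> 0"
    and lambda: "(\<lambda>n. lam n / real n) \<longlonglongrightarrow> lam0" "lam0 \<ge> 0"
    and min: "is_minimizer (Zlim S B \<gamma> \<rho>0 lam0) \<theta>"
  shows "tendsto_in_prob M \<theta>hat \<theta>"
  unfolding tendsto_in_prob_def
proof (intro allI impI)
  fix e :: real
  assume e: "e > 0"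
  interpret prob_space M by (rule prob_M)
  let ?\<xi> = "\<lambda>i. coord (X i, z i)" and ?F = "Zlim S B \<gamma> \<rho>0 lam0"
  let ?noise = "\<lambda>n \<omega>. (1 / real n) *\<^sub>R (\<Sum>i=1..n. \<epsilon> i \<omega> *\<^sub>R ?\<xi> i)"
  obtain c where c: "c > 0" "\<And>v. c * (norm v)\<^sup>2 \<le> v \<bullet> (S *v v)"
    using pos_def_coercive[OF S] by blast
  define k where "k = c / 2"
  have k: "k * e\<^sup>2 > 0" using c(1) e by (simp add: k_def)
  have growth: "?F \<theta> + k * (norm (x - \<theta>))\<^sup>2 \<le> ?F x" for x
    unfolding k_def by (rule Zlim_quadratic_growth[OF c(2) rho(2) lambda(2) min])
  \<comment> \<open>The comparison takes place on the \<open>e\<close>-ball around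
    \<open>\<theta>\<close>, whereas the quadratic and linear terms are centred at
    \<open>(B, \<gamma>)\<close>; \<open>R\<close> bounds the distance from that centre.\<close>
  define R where "R = e + norm (\<theta> - (B, \<gamma>))"
  have R: "R > 0" using e by (simp add: R_def add_pos_nonneg)
  have R': "norm (x - (B, \<gamma>)) \<le> R" if "norm (x - \<theta>) \<le> e" for x
    using that dist_triangle[of x "(B, \<gamma>)" \<theta>] by (simp add: R_def dist_norm)
  have cont: "continuous_on (cball \<theta> e) (penalty 1 1)"
    by (rule continuous_on_subset[OF continuous_on_penalty]) simp
  have "cball \<theta> e \<noteq> {}" using e by auto
  then obtain x0 where x0: "x0 \<in> cball \<theta> e" "\<And>x. x \<in> cball \<theta> e \<Longrightarrow> penalty 1 1 x \<le> penalty 1 1 x0"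
    using continuous_attains_sup[OF compact_cball _ cont] by blast
  \<comment> \<open>The maximum of the sum of the two norms on the ball bounds each of them, since
    both are nonnegative.\<close>
  define K where "K = penalty 1 1 x0"
  have K: "nuclear_norm (fst x) \<le> K" "l1_norm (snd x) \<le> K" if "norm (x - \<theta>) \<le> e" for x
    using x0(2)[of x] that nuclear_norm_nonneg[of "fst x"] l1_norm_nonneg[of "snd x"]
    by (auto simp: K_def penalty_def[of 1 1 x] dist_norm norm_minus_commute)
  define a where "a n = norm (second_moment ?\<xi> n - S) * R\<^sup>2
      + (\<bar>\<rho> n / real n - \<rho>0\<bar> * K + \<bar>lam n / real n - lam0\<bar> * K)" for n
  have "a \<longlonglongrightarrow> norm (S - S) * R\<^sup>2 + (\<bar>\<rho>0 - \<rho>0\<bar> * K + \<bar>lam0 - lam0\<bar> * K)"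
    unfolding a_def by (intro tendsto_intros S_lim rho(1) lambda(1))
  then have "a \<longlonglongrightarrow> 0" by simp
  then have a_small: "eventually (\<lambda>n. a n < k * e\<^sup>2 / 4) sequentially"
    using k by (intro order_tendstoD(2)) auto
  \<comment> \<open>With this choice \<open>4 * \<tau> * R\<close> is half of
    \<open>k * e\<^sup>2\<close>, and the bound on \<open>a n\<close> makes \<open>2 * a n\<close>
    less than the other half.\<close>
  define \<tau> where "\<tau> = k * e\<^sup>2 / (8 * R)"
  have \<tau>: "\<tau> > 0" using k R by (simp add: \<tau>_def)
  have sub: "{\<omega> \<in> space M. dist (\<theta>hat n \<omega>) \<theta> > e} \<subseteq> {\<omega> \<in> space M. norm (?noise n \<omega>) \<ge> \<tau>}"
    if n: "n \<ge> 1" and an: "a n < k * e\<^sup>2 / 4" for n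
  proof -
    have "dist (\<theta>hat n \<omega>) \<theta> \<le> e" if \<omega>: "\<omega> \<in> space M" and noise: "norm (?noise n \<omega>) \<le> \<tau>" for \<omega>
    \<comment> \<open>The reference function is \<open>?F\<close> plus the random constant
      \<open>?c\<close>, a shift that preserves the minimizer and the growth.\<close>
    proof (rule perturbed_minimizer_close[OF _ _ _ e])
      let ?G = "Zn X z (\<lambda>i. y i \<omega>) \<rho> lam n"
      let ?c = "(\<Sum>i=1..n. (\<epsilon> i \<omega>)\<^sup>2) / real n"
      show "convex_on UNIV ?G" by (rule convex_on_Zn) (use pen n in auto)
      show "(?F \<theta> + ?c) + k * (norm (x - \<theta>))\<^sup>2 \<le> ?F x + ?c" for x
        using growth[of x] by simp
      show "\<bar>?G x - (?F x + ?c)\<bar> \<le> 2 * (\<tau> * R) + a n" if "norm (x - \<theta>) \<le> e" for x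
        unfolding a_def using that model \<omega> noise R' K by (intro Zn_close_to_Zlim) auto
      show "2 * (2 * (\<tau> * R) + a n) < k * e\<^sup>2"
        using an R by (simp add: \<tau>_def)
      show "?G (\<theta>hat n \<omega>) \<le> ?G \<theta>"
        using estimator[OF n \<omega>] unfolding is_arg_min_linorder by blast
    qed
    then show ?thesis by force
  qed
  have trace_lim: "(\<lambda>n. (\<Sum>i=1..n. (norm (?\<xi> i))\<^sup>2) / real n) \<longlonglongrightarrow> trace S"
    unfolding trace_second_moment trace_def by (intro tendsto_intros S_lim)
  note noise_lim = normal_noise_average_tendsto_zero[OF indep \<sigma> normal trace_lim \<tau>]
  have "eventually (\<lambda>n. prob {\<omega> \<in> space M. dist (\<theta>hat n \<omega>) \<theta> > e}
      \<le> prob {\<omega> \<in> space M. norm (?noise n \<omega>) \<ge> \<tau>}) sequentially"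
    \<comment> \<open>The index 0, at which the estimator and the weights are unconstrained, is
      discarded here.\<close>
    using a_small eventually_ge_at_top[of 1]
    by eventually_elim (intro finite_measure_mono sub noise_lim(1))
  then show "(\<lambda>n. prob {\<omega> \<in> space M. dist (\<theta>hat n \<omega>) \<theta> > e}) \<longlonglongrightarrow> 0"
    by (intro tendsto_sandwich[OF _ _ tendsto_const noise_lim(2)]) auto
qed

lemma Collect_eq_singleton_if_ex1: "\<exists>!x. P x \<Longrightarrow> P a \<Longrightarrow> {x. P x} = {a}"
  by blast

text \<open>\<open>arg_min\<close> is a choice operator; the first conjunct, unique existence, is
  what makes it denote the minimizer. Measurability of the estimator gives the probabilities in
  \<open>tendsto_in_prob\<close> their intended meaning.\<close>

theorem theorem2p1:
  fixes M :: "'a measure"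
    and X :: "nat \<Rightarrow> real^'q^'m" and z :: "nat \<Rightarrow> real^'p"
    and B :: "real^'q^'m" and \<gamma> :: "real^'p"
    and \<epsilon> y :: "nat \<Rightarrow> 'a \<Rightarrow> real" and \<sigma> :: real
    and \<rho> lam :: "nat \<Rightarrow> real" and \<rho>0 lam0 :: real
    and Bhat :: "nat \<Rightarrow> 'a \<Rightarrow> real^'q^'m" and \<gamma>hat :: "nat \<Rightarrow> 'a \<Rightarrow> real^'p"
    and C :: "real^('q \<times> 'm)^('q \<times> 'm)" and D :: "real^'p^'p" and H :: "real^'p^('q \<times> 'm)"
  assumes prob_M: "prob_space M"
    and sigma_pos: "\<sigma> > 0"
    and noise_indep: "prob_space.indep_vars M (\<lambda>_. borel) \<epsilon> {1..}"
    and noise_normal: "\<And>i. i \<ge> 1 \<Longrightarrow> distributed M lborel (\<epsilon> i) (normal_density 0 \<sigma>)"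
    and model: "\<And>i \<omega>. i \<ge> 1 \<Longrightarrow> \<omega> \<in> space M \<Longrightarrow> y i \<omega> = mat_inner (X i) B + z i \<bullet> \<gamma> + \<epsilon> i \<omega>"
    and penalties_nonneg: "\<And>n. n \<ge> 1 \<Longrightarrow> \<rho> n \<ge> 0" "\<And>n. n \<ge> 1 \<Longrightarrow> lam n \<ge> 0"
    and estimator_measurable:
      "\<And>n. n \<ge> 1 \<Longrightarrow> Bhat n \<in> borel_measurable M" "\<And>n. n \<ge> 1 \<Longrightarrow> \<gamma>hat n \<in> borel_measurable M"
    and estimator: "\<And>n \<omega>. n \<ge> 1 \<Longrightarrow> \<omega> \<in> space M \<Longrightarrow>
      is_minimizer (Zn X z (\<lambda>i. y i \<omega>) \<rho> lam n) (Bhat n \<omega>, \<gamma>hat n \<omega>)"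
    and C_lim: "(\<lambda>n. (1 / real n) *\<^sub>R (\<Sum>i=1..n. outer_product (vectorize (X i)) (vectorize (X i)))) \<longlonglongrightarrow> C"
    and D_lim: "(\<lambda>n. (1 / real n) *\<^sub>R (\<Sum>i=1..n. outer_product (z i) (z i))) \<longlonglongrightarrow> D"
    and H_lim: "(\<lambda>n. (1 / real n) *\<^sub>R (\<Sum>i=1..n. outer_product (vectorize (X i)) (z i))) \<longlonglongrightarrow> H"
    and C_psd: "pos_semidef C" and D_psd: "pos_semidef D"
    and S_pd: "pos_def (block_mat C H (transpose H) D)"
    and rho_lim: "(\<lambda>n. \<rho> n / real n) \<longlonglongrightarrow> \<rho>0" "\<rho>0 \<ge> 0"
    and lambda_lim: "(\<lambda>n. lam n / real n) \<longlonglongrightarrow> lam0" "lam0 \<ge> 0"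
  shows "(\<exists>!\<theta>. is_minimizer (Zlim (block_mat C H (transpose H) D) B \<gamma> \<rho>0 lam0) \<theta>) \<and>
    tendsto_in_prob M (\<lambda>n \<omega>. (Bhat n \<omega>, \<gamma>hat n \<omega>))
      (arg_min (Zlim (block_mat C H (transpose H) D) B \<gamma> \<rho>0 lam0) (\<lambda>_. True)) \<and>
    (\<rho> \<in> o(\<lambda>n. real n) \<and> lam \<in> o(\<lambda>n. real n) \<longrightarrow>
      {\<theta>. is_minimizer (Zlim (block_mat C H (transpose H) D) B \<gamma> \<rho>0 lam0) \<theta>} = {(B, \<gamma>)} \<and>
      tendsto_in_prob M (\<lambda>n \<omega>. (Bhat n \<omega>, \<gamma>hat n \<omega>)) (B, \<gamma>))"
proof -
  let ?S = "block_mat C H (transpose H) D"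
  let ?F = "Zlim ?S B \<gamma> \<rho>0 lam0"
  have ex1: "\<exists>!\<theta>. is_minimizer ?F \<theta>"
    by (rule Zlim_ex1_minimizer[OF S_pd rho_lim(2) lambda_lim(2)])
  have min: "is_minimizer ?F (arg_min ?F (\<lambda>_. True))"
    unfolding arg_min_def by (rule someI_ex[OF ex1_implies_ex[OF ex1]])
  have conv: "tendsto_in_prob M (\<lambda>n \<omega>. (Bhat n \<omega>, \<gamma>hat n \<omega>)) (arg_min ?F (\<lambda>_. True))"
    by (rule estimator_tendsto_in_prob[OF prob_M sigma_pos noise_indep noise_normal model
          penalties_nonneg estimator second_moment_coord_tendsto[OF C_lim D_lim H_lim] S_pd
          rho_lim lambda_lim min])
  have consistent: "{\<theta>. is_minimizer ?F \<theta>} = {(B, \<gamma>)}"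
      "tendsto_in_prob M (\<lambda>n \<omega>. (Bhat n \<omega>, \<gamma>hat n \<omega>)) (B, \<gamma>)"
    if o: "\<rho> \<in> o(\<lambda>n. real n) \<and> lam \<in> o(\<lambda>n. real n)"
  proof -
    \<comment> \<open>The condition \<open>o(n)\<close> says that the ratios tend to 0, so
      uniqueness of limits annihilates both limiting weights.\<close>
    have zero: "\<rho>0 = 0" "lam0 = 0"
      using LIMSEQ_unique[OF rho_lim(1) smalloD_tendsto] LIMSEQ_unique[OF lambda_lim(1) smalloD_tendsto] o
      by simp_all
    have "x \<bullet> (?S *v x) \<ge> 0" for x
      using S_pd unfolding pos_def_def by (cases "x = 0") (auto intro: less_imp_le)
    \<comment> \<open>Without penalty only the nonnegative quadratic form remains, and it vanishes
      at \<open>(B, \<gamma>)\<close>.\<close>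
    then have B\<gamma>: "is_minimizer ?F (B, \<gamma>)"
      unfolding is_arg_min_linorder Zlim_eq zero by (simp add: penalty_def coord_simps)
    show set: "{\<theta>. is_minimizer ?F \<theta>} = {(B, \<gamma>)}"
      by (rule Collect_eq_singleton_if_ex1[OF ex1 B\<gamma>])
    have "arg_min ?F (\<lambda>_. True) \<in> {(B, \<gamma>)}"
      using min unfolding set[symmetric] by (rule CollectI)
    then have "arg_min ?F (\<lambda>_. True) = (B, \<gamma>)"
      by (rule singletonD)
    then show "tendsto_in_prob M (\<lambda>n \<omega>. (Bhat n \<omega>, \<gamma>hat n \<omega>)) (B, \<gamma>)"
      using conv by simp
  qed
  show ?thesis by (intro conjI impI ex1 conv consistent; elim conjE)
qed

end
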